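(* Let $n\ge 4$ and let $S(a,b)$ be a double star tree on $n$ vertices, where $a,b\ge 1$ are integers with $a+b=n-2$. Then $$n^2+3n+\frac{4}{n}-16\leq BH(S(a,b))\leq n^2-2n+4\left\lceil\frac{n-2}{2}\right\rceil\left\lfloor\frac{n-2}{2}\right\rfloor+\frac{\left(\lceil\frac{n-2}{2}\rceil\lfloor\frac{n-2}{2}\rfloor+1\right)^2}{n},$$ where the left equality holds if and only if $S(a,b)\cong S(1,n-3)$, and the right equality holds if and only if $S(a,b)\cong S(\lceil\frac{n-2}{2}\rceil, \lfloor\frac{n-2}{2}\rfloor)$.
   Context: The double star $S(a,b)$ is the tree obtained from $K_2$ by attaching $a$ pendant edges to one endpoint and $b$ pendant edges to the other. For a graph $G$ on $n$ vertices with Laplacian $L(G)=D(G)-A(G)$ and Laplacian eigenvalues $0=\lambda_1\le\lambda_2\le\cdots\le\lambda_n$, the biharmonic index is $BH(G)=\frac12\sum_{u,v}d_B^2(u,v)$ ($d_B^2$ the squared biharmonic distance), equivalently $BH(G)=n\sum_{i=2}^n\lambda_i^{-2}$. *)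

theory Defs
  imports
    "Graph_Theory.Pair_Digraph"
    "Graph_Theory.Digraph_Isomorphism"
    "Jordan_Normal_Form.Matrix"
begin

(* Simple graphs are the pair_graph digraphs of Graph_Theory: an undirected edge uv is the pair of
   arcs (u, v) and (v, u), so out_degree is the degree. So that matrices can be indexed by vertices,
   a graph of order n is expected to have vertex set {0..<n}. *)

definition adjacency_mat :: "nat pair_pre_digraph \<Rightarrow> real mat" where
  "adjacency_mat G = mat (card (pverts G)) (card (pverts G))
     (\<lambda>(u, v). if (u, v) \<in> parcs G then 1 else 0)"

definition degree_mat :: "nat pair_pre_digraph \<Rightarrow> real mat" where
  "degree_mat G = mat (card (pverts G)) (card (pverts G))
     (\<lambda>(u, v). if u = v then real (out_degree (with_proj G) u) else 0)"

definition laplacian_mat :: "nat pair_pre_digraph \<Rightarrow> real mat" where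
  "laplacian_mat G = degree_mat G - adjacency_mat G"

definition is_moore_penrose :: "real mat \<Rightarrow> real mat \<Rightarrow> bool" where
  "is_moore_penrose A X \<longleftrightarrow>
     X \<in> carrier_mat (dim_col A) (dim_row A) \<and>
     A * X * A = A \<and>
     X * A * X = X \<and>
     transpose_mat (A * X) = A * X \<and>
     transpose_mat (X * A) = X * A"

lemma is_moore_penrose_unique:
  assumes "is_moore_penrose A X" "is_moore_penrose A Y"
  shows "X = Y"
proof -
  define m n where "m = dim_row A" and "n = dim_col A"
  have A: "A \<in> carrier_mat m n" unfolding m_def n_def by (rule carrier_matI[OF refl refl])
  have X: "X \<in> carrier_mat n m" "A * X * A = A" "X * A * X = X"
      "transpose_mat (A * X) = A * X" "transpose_mat (X * A) = X * A"
    and Y: "Y \<in> carrier_mat n m" "A * Y * A = A" "Y * A * Y = Y"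
      "transpose_mat (A * Y) = A * Y" "transpose_mat (Y * A) = Y * A"
    using assms unfolding is_moore_penrose_def m_def n_def by blast+
  have AX: "A * X \<in> carrier_mat m m" and AY: "A * Y \<in> carrier_mat m m"
    and XA: "X * A \<in> carrier_mat n n" and YA: "Y * A \<in> carrier_mat n n"
    using mult_carrier_mat[OF A X(1)] mult_carrier_mat[OF A Y(1)]
      mult_carrier_mat[OF X(1) A] mult_carrier_mat[OF Y(1) A] by blast+
  have "A * X = (A * Y * A) * X" by (simp only: Y(2))
  also have "\<dots> = (A * Y) * (A * X)" by (rule assoc_mult_mat[OF AY A X(1)])
  also have "\<dots> = transpose_mat ((A * X) * (A * Y))"
    by (simp only: transpose_mult[OF AX AY] X(4) Y(4))
  also have "(A * X) * (A * Y) = A * X * A * Y" by (rule assoc_mult_mat[OF AX A Y(1), symmetric])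
  also have "transpose_mat (A * X * A * Y) = A * Y" by (simp only: X(2) Y(4))
  finally have eq1: "A * X = A * Y" .
  have "X * A = X * (A * Y * A)" by (simp only: Y(2))
  also have "\<dots> = X * (A * (Y * A))" by (simp only: assoc_mult_mat[OF A Y(1) A])
  also have "\<dots> = (X * A) * (Y * A)" by (rule assoc_mult_mat[OF X(1) A YA, symmetric])
  also have "\<dots> = transpose_mat ((Y * A) * (X * A))"
    by (simp only: transpose_mult[OF YA XA] X(5) Y(5))
  also have "(Y * A) * (X * A) = Y * (A * (X * A))" by (rule assoc_mult_mat[OF Y(1) A XA])
  also have "A * (X * A) = A" using assoc_mult_mat[OF A X(1) A] X(2) by (rule trans[OF sym])
  also have "transpose_mat (Y * A) = Y * A" by (rule Y(5))
  finally have eq2: "X * A = Y * A" .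
  have "X = X * (A * X)" by (rule trans[OF X(3)[symmetric] assoc_mult_mat[OF X(1) A X(1)]])
  also have "\<dots> = X * (A * Y)" by (simp only: eq1)
  also have "\<dots> = X * A * Y" by (rule assoc_mult_mat[OF X(1) A Y(1), symmetric])
  also have "\<dots> = Y" by (simp only: eq2 Y(3))
  finally show ?thesis .
qed

definition moore_penrose :: "real mat \<Rightarrow> real mat" where
  "moore_penrose A = (THE X. is_moore_penrose A X)"

(* With M the square of the pseudoinverse of the Laplacian (equivalently, the pseudoinverse of its
   square), the squared biharmonic distance of u and v is M_uu + M_vv - 2 M_uv. *)
definition biharmonic_dist_sq :: "nat pair_pre_digraph \<Rightarrow> nat \<Rightarrow> nat \<Rightarrow> real" where
  "biharmonic_dist_sq G u v =
     (let M = moore_penrose (laplacian_mat G) * moore_penrose (laplacian_mat G)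
      in M $$ (u, u) + M $$ (v, v) - 2 * M $$ (u, v))"

definition biharmonic_index :: "nat pair_pre_digraph \<Rightarrow> real" where
  "biharmonic_index G =
     1 / 2 * (\<Sum>u\<in>pverts G. \<Sum>v\<in>pverts G. biharmonic_dist_sq G u v)"

(* The copy of K_2 is on the vertices 0 and 1; the vertices 2, ..., a + 1 are pendant at 0 and
   a + 2, ..., a + b + 1 are pendant at 1. *)
definition double_star_edges :: "nat \<Rightarrow> nat \<Rightarrow> (nat \<times> nat) set" where
  "double_star_edges a b =
     {(0, 1)} \<union> Pair 0 ` {2..<a + 2} \<union> Pair 1 ` {a + 2..<a + b + 2}"

definition double_star :: "nat \<Rightarrow> nat \<Rightarrow> nat pair_pre_digraph" where
  "double_star a b =
     \<lparr> pverts = {0..<a + b + 2},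
       parcs = double_star_edges a b \<union> (double_star_edges a b)\<inverse> \<rparr>"

lemma pair_graph_double_star: "pair_graph (double_star a b)"
proof
  show "finite (parcs (double_star a b))"
    by (simp add: double_star_def double_star_edges_def)
  show "symmetric (with_proj (double_star a b))"
    by (auto simp: symmetric_def double_star_def sym_def)
qed (auto simp: double_star_def double_star_edges_def)

abbreviation graph_iso :: "'a pair_pre_digraph \<Rightarrow> 'b pair_pre_digraph \<Rightarrow> bool" where
  "graph_iso G H \<equiv> digraph_iso (with_proj G) (with_proj H)"

end

theory Submission
  imports Defs
begin

text \<open>Write the Laplacian of a rooted tree as \<open>L = B B\<^sup>T\<close> with \<open>B\<close> the oriented incidence matrix, and
  let column \<open>e\<close> of \<open>H\<close> be the indicator of the subtree below the edge \<open>e\<close>, centred to have sum zero.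
  Then \<open>B\<^sup>T H = I\<close> and \<open>B H\<^sup>T\<close> is the projection \<open>I - J / n\<close>, so \<open>L\<^sup>+ = H H\<^sup>T\<close> and the biharmonic
  index is \<open>n\<close> times the sum of the squared entries of the Gram matrix \<open>H\<^sup>T H\<close>. For \<open>S(a, b)\<close> this
  gives \<open>n\<^sup>2 - 2 n + 4 a b + (a b + 1)\<^sup>2 / n\<close>, which is strictly increasing in \<open>a b\<close>. With \<open>a + b\<close> fixed,
  \<open>a b\<close> is least at \<open>a = 1\<close>, greatest in the balanced case, and determines \<open>{a, b}\<close>, hence the
  isomorphism class; conversely the vertex degrees recover \<open>{a, b}\<close>.\<close>

section \<open>Pseudoinverses from factorisations and the trace formula\<close>

lemma moore_penrose_eqI:
  assumes "is_moore_penrose A X"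
  shows "moore_penrose A = X"
  unfolding moore_penrose_def
  using assms is_moore_penrose_unique by (intro the_equality)

text \<open>\<open>B\<^sup>T H = I\<close> and its transpose \<open>H\<^sup>T B = I\<close> cancel
  every inner pair of factors, so the two products of the Penrose conditions collapse to
  \<open>B H\<^sup>T\<close> and \<open>H B\<^sup>T\<close>. These are transposes of each other,
  hence equal by \<open>sym\<close>.\<close>

lemma is_moore_penrose_mult_transpose:
  assumes B: "B \<in> carrier_mat n m" and H: "H \<in> carrier_mat n m"
    and inv: "transpose_mat B * H = 1\<^sub>m m"
    and sym: "transpose_mat (B * transpose_mat H) = B * transpose_mat H"
  shows "is_moore_penrose (B * transpose_mat B) (H * transpose_mat H)"
proof -
  let ?B' = "transpose_mat B" and ?H' = "transpose_mat H"
  have B': "?B' \<in> carrier_mat m n" and H': "?H' \<in> carrier_mat m n"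
    using B H by auto
  have BB: "B * ?B' \<in> carrier_mat n n" and HH: "H * ?H' \<in> carrier_mat n n"
    and BH: "B * ?H' \<in> carrier_mat n n"
    using B H by auto
  have inv': "?H' * B = 1\<^sub>m m"
    using transpose_mult[OF B' H] inv by simp
  have cancel: "?B' * (H * Z) = Z" "?H' * (B * Z) = Z" if "Z \<in> carrier_mat m n" for Z
    using assoc_mult_mat[OF B' H that] assoc_mult_mat[OF H' B that] inv inv' that by simp_all
  have AX: "B * ?B' * (H * ?H') = B * ?H'"
    using assoc_mult_mat[OF B B' HH] cancel(1)[OF H'] by simp
  have XA: "H * ?H' * (B * ?B') = H * ?B'"
    using assoc_mult_mat[OF H H' BB] cancel(2)[OF B'] by simp
  have sym': "H * ?B' = B * ?H'"
    using transpose_mult[OF B H'] sym by simp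
  have "B * ?B' * (H * ?H') * (B * ?B') = B * ?B'"
    unfolding AX using assoc_mult_mat[OF B H' BB] cancel(2)[OF B'] by simp
  moreover have "H * ?H' * (B * ?B') * (H * ?H') = H * ?H'"
    unfolding XA using assoc_mult_mat[OF H B' HH] cancel(1)[OF H'] by simp
  ultimately show ?thesis
    unfolding is_moore_penrose_def AX XA sym' using HH BB sym by auto
qed

text \<open>Zero column sums make all entries of \<open>M = (L\<^sup>+)\<^sup>2\<close> sum to zero, so the index is \<open>n\<close> times the
  trace of \<open>M\<close>, and the trace is the squared Frobenius norm of the Gram matrix.\<close>

lemma biharmonic_index_gram:
  fixes h :: "nat \<Rightarrow> nat \<Rightarrow> real"
  assumes verts: "pverts G = {0..<n}"
    and pinv: "moore_penrose (laplacian_mat G) =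
      mat n m (\<lambda>(u, j). h u j) * transpose_mat (mat n m (\<lambda>(u, j). h u j))"
    and zero: "\<And>j. j < m \<Longrightarrow> (\<Sum>u<n. h u j) = 0"
  shows "biharmonic_index G = real n * (\<Sum>j<m. \<Sum>k<m. (\<Sum>u<n. h u j * h u k)\<^sup>2)"
proof -
  define X where "X u v = (\<Sum>j<m. h u j * h v j)" for u v
  define M where "M u v = (\<Sum>w<n. X u w * X w v)" for u v
  have pinv_index: "moore_penrose (laplacian_mat G) $$ (u, v) = X u v" if "u < n" "v < n" for u v
    using that unfolding pinv
    by (simp add: scalar_prod_def X_def atLeast0LessThan)
  have M_index: "(moore_penrose (laplacian_mat G) * moore_penrose (laplacian_mat G)) $$ (u, v) = M u v"
    if "u < n" "v < n" for u v
  proof -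
    have dims: "dim_row (moore_penrose (laplacian_mat G)) = n"
      "dim_col (moore_penrose (laplacian_mat G)) = n"
      by (simp_all add: pinv)
    show ?thesis
      using that
      by (simp add: scalar_prod_def dims M_def atLeast0LessThan pinv_index)
  qed
  have "biharmonic_index G = 1 / 2 * (\<Sum>u<n. \<Sum>v<n. M u u + M v v - 2 * M u v)"
    unfolding biharmonic_index_def biharmonic_dist_sq_def verts
    by (simp add: M_index atLeast0LessThan Let_def)
  \<comment> \<open>Each of the two diagonal terms contributes \<open>n\<close> times the trace,
    which absorbs the factor 1/2.\<close>
  also have "\<dots> = real n * (\<Sum>u<n. M u u) - (\<Sum>u<n. \<Sum>v<n. M u v)"
    by (simp add: sum.distrib sum_subtractf sum_distrib_left[symmetric])
  also have "(\<Sum>u<n. \<Sum>v<n. M u v) = 0"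
  proof -
    have row_sum: "(\<Sum>v<n. X w v) = 0" for w
    proof -
      have "(\<Sum>v<n. X w v) = (\<Sum>j<m. h w j * (\<Sum>v<n. h v j))"
        unfolding X_def sum_distrib_left by (rule sum.swap)
      then show ?thesis by (simp add: zero)
    qed
    have "(\<Sum>v<n. M u v) = (\<Sum>w<n. X u w * (\<Sum>v<n. X w v))" for u
      unfolding M_def sum_distrib_left by (rule sum.swap)
    then show ?thesis by (simp add: row_sum)
  qed
  also have "(\<Sum>u<n. M u u) = (\<Sum>j<m. \<Sum>k<m. (\<Sum>u<n. h u j * h u k)\<^sup>2)"
  proof -
    \<comment> \<open>Grouping the four factors by vertex instead of by column lets the sum split
      into a \<open>u\<close>-part and an equal \<open>w\<close>-part once the vertex sums are
      innermost.\<close>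
    have "(\<Sum>u<n. M u u) = (\<Sum>u<n. \<Sum>w<n. \<Sum>j<m. \<Sum>k<m. (h u j * h u k) * (h w j * h w k))"
      unfolding M_def X_def sum_product by (intro sum.cong refl) (simp add: mult_ac)
    also have "\<dots> = (\<Sum>u<n. \<Sum>j<m. \<Sum>w<n. \<Sum>k<m. (h u j * h u k) * (h w j * h w k))"
      by (rule sum.cong[OF refl], rule sum.swap)
    also have "\<dots> = (\<Sum>j<m. \<Sum>u<n. \<Sum>k<m. \<Sum>w<n. (h u j * h u k) * (h w j * h w k))"
      by (subst sum.swap, rule sum.cong[OF refl], rule sum.cong[OF refl], rule sum.swap)
    also have "\<dots> = (\<Sum>j<m. \<Sum>k<m. (\<Sum>u<n. h u j * h u k)\<^sup>2)"
      unfolding power2_eq_square sum_product by (rule sum.cong[OF refl], rule sum.swap)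
    finally show ?thesis .
  qed
  finally show ?thesis by simp
qed

section \<open>The Laplacian of a rooted tree from its incidence matrix\<close>

text \<open>Edge \<open>j\<close> joins the vertex \<open>Suc j\<close> to its parent
  \<open>p j\<close>. Since \<open>p j \<le> j\<close>, parents have smaller numbers: there are no
  loops, and distinct indices give distinct edges.\<close>

lemma laplacian_mat_eq_incidence:
  fixes p :: "nat \<Rightarrow> nat"
  assumes verts: "pverts G = {0..<Suc m}"
    and arcs: "parcs G = (\<lambda>j. (Suc j, p j)) ` {..<m} \<union> (\<lambda>j. (p j, Suc j)) ` {..<m}"
    and parent: "\<And>j. j < m \<Longrightarrow> p j \<le> j"
  defines "B \<equiv> mat (Suc m) m (\<lambda>(u, j). of_bool (u = Suc j) - of_bool (u = p j))"
  shows "laplacian_mat G = B * transpose_mat B"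
proof (rule eq_matI)
  fix u v assume "u < dim_row (B * transpose_mat B)" "v < dim_col (B * transpose_mat B)"
  then have uv: "u < Suc m" "v < Suc m" by (auto simp: B_def)
  have BB: "(B * transpose_mat B) $$ (u, v) = (\<Sum>j<m. (of_bool (u = Suc j) - of_bool (u = p j)) *
      (of_bool (v = Suc j) - of_bool (v = p j)))"
    using uv by (simp add: B_def scalar_prod_def atLeast0LessThan)
  have L: "laplacian_mat G $$ (u, v) =
      (if u = v then real (out_degree (with_proj G) u) else 0) - of_bool ((u, v) \<in> parcs G)"
    using uv by (simp add: laplacian_mat_def degree_mat_def adjacency_mat_def verts)
  show "laplacian_mat G $$ (u, v) = (B * transpose_mat B) $$ (u, v)"
  proof (cases "u = v")
    case True
    \<comment> \<open>The arcs leaving \<open>u\<close> are indexed by the edges at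
      \<open>u\<close>; the head is the parent if \<open>u\<close> is the child end, and the child
      otherwise.\<close>
    have "out_arcs (with_proj G) u =
        (\<lambda>j. (u, if u = Suc j then p j else Suc j)) ` {j. j < m \<and> (u = Suc j \<or> u = p j)}"
      using parent by (force simp: out_arcs_def arcs)
    moreover have "inj_on (\<lambda>j. (u, if u = Suc j then p j else Suc j))
        {j. j < m \<and> (u = Suc j \<or> u = p j)}"
    proof (rule inj_onI)
      fix i j
      assume "i \<in> {j. j < m \<and> (u = Suc j \<or> u = p j)}" "j \<in> {j. j < m \<and> (u = Suc j \<or> u = p j)}"
        and "(u, if u = Suc i then p i else Suc i) = (u, if u = Suc j then p j else Suc j)"
      \<comment> \<open>The only delicate case has \<open>u\<close> as child in one edge and parent
        in the other: equal heads would then give both \<open>i < j\<close> and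
        \<open>j < i\<close>.\<close>
      moreover have "i = j"
        if "x \<le> i" "y \<le> j" "u = Suc i \<or> u = x" "u = Suc j \<or> u = y"
          "(if u = Suc i then x else Suc i) = (if u = Suc j then y else Suc j)" for x y
        using that by (auto split: if_splits)
      ultimately show "i = j"
        using parent by blast
    qed
    ultimately have "out_degree (with_proj G) u = card {j. j < m \<and> (u = Suc j \<or> u = p j)}"
      by (simp add: out_degree_def card_image)
    also have "real \<dots> = (\<Sum>j<m. of_bool (u = Suc j \<or> u = p j))"
      by (simp add: sum.If_cases of_bool_def Int_def)
    \<comment> \<open>The two conditions exclude each other, so the difference is 0, 1 or -1 and its
      square is the indicator of their disjunction.\<close>
    also have "\<dots> = (\<Sum>j<m. (of_bool (u = Suc j) - of_bool (u = p j)) *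
        (of_bool (u = Suc j) - of_bool (u = p j)))"
      using parent by (intro sum.cong) (auto simp: of_bool_def dest: parent)
    finally have deg: "real (out_degree (with_proj G) u) = \<dots>" .
    have "(u, u) \<notin> parcs G"
      using parent by (force simp: arcs)
    then show ?thesis
      unfolding BB L using True deg by simp
  next
    case False
    \<comment> \<open>For distinct \<open>u\<close> and \<open>v\<close> only the mixed child-parent
      products survive.\<close>
    have "(\<Sum>j<m. (of_bool (u = Suc j) - of_bool (u = p j)) *
        (of_bool (v = Suc j) - of_bool (v = p j))) =
      (\<Sum>j<m. - (if u = Suc j then of_bool (v = p j) else 0 :: real)
        - (if v = Suc j then of_bool (u = p j) else 0))"
      using False by (intro sum.cong) auto
    also have "\<dots> = - (\<Sum>j<m. if u = Suc j then of_bool (v = p j) else 0)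
        - (\<Sum>j<m. if v = Suc j then of_bool (u = p j) else 0)"
      by (simp add: sum_subtractf sum_negf)
    also have "(\<Sum>j<m. if u = Suc j then of_bool (v = p j) else 0 :: real) =
        of_bool (\<exists>j<m. u = Suc j \<and> v = p j)"
      using uv by (cases u) auto
    also have "(\<Sum>j<m. if v = Suc j then of_bool (u = p j) else 0 :: real) =
        of_bool (\<exists>j<m. v = Suc j \<and> u = p j)"
      using uv by (cases v) auto
    also have "- of_bool (\<exists>j<m. u = Suc j \<and> v = p j) - of_bool (\<exists>j<m. v = Suc j \<and> u = p j) =
        (- of_bool ((u, v) \<in> parcs G) :: real)"
    proof -
      \<comment> \<open>The order of \<open>u\<close> and \<open>v\<close> decides which end is the
        child, so at most one of the two indicators is nonzero.\<close>
      have "v < u" if "\<exists>j<m. u = Suc j \<and> v = p j"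
        using that parent by (auto simp: less_Suc_eq_le)
      moreover have "u < v" if "\<exists>j<m. v = Suc j \<and> u = p j"
        using that parent by (auto simp: less_Suc_eq_le)
      moreover have "(u, v) \<in> parcs G \<longleftrightarrow>
          (\<exists>j<m. u = Suc j \<and> v = p j) \<or> (\<exists>j<m. v = Suc j \<and> u = p j)"
        unfolding arcs by auto
      ultimately show ?thesis by (simp only: of_bool_def) force
    qed
    finally show ?thesis
      unfolding BB L using False by simp
  qed
qed (simp_all add: laplacian_mat_def degree_mat_def adjacency_mat_def verts B_def)

section \<open>Centred indicators of vertex sets\<close>

text \<open>For \<open>S\<close> inside \<open>{..<n}\<close> this is the orthogonal projection of
  its indicator vector onto the complement of the constants.\<close>

definition centred_indicator :: "nat \<Rightarrow> nat set \<Rightarrow> nat \<Rightarrow> real" where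
  "centred_indicator n S u = of_bool (u \<in> S) - real (card S) / real n"

lemma sum_of_bool_mem:
  fixes n :: nat
  assumes "S \<subseteq> {..<n}"
  shows "(\<Sum>u<n. of_bool (u \<in> S)) = real (card S)"
  using assms by (simp add: Int_absorb1)

lemma sum_centred_indicator:
  assumes "S \<subseteq> {..<n}" "n > 0"
  shows "(\<Sum>u<n. centred_indicator n S u) = 0"
  using assms by (simp add: centred_indicator_def sum_subtractf Int_absorb1)

lemma sum_centred_indicator_mult:
  assumes "S \<subseteq> {..<n}" "T \<subseteq> {..<n}" "n > 0"
  shows "(\<Sum>u<n. centred_indicator n S u * centred_indicator n T u) =
    real (card (S \<inter> T)) - real (card S) * real (card T) / real n"
proof -
  have Int_subset: "S \<inter> T \<subseteq> {..<n}" using assms(1) by blast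
  have "(\<Sum>u<n. centred_indicator n S u * centred_indicator n T u) =
      (\<Sum>u<n. of_bool (u \<in> S \<inter> T) - real (card T) / real n * of_bool (u \<in> S)
        - real (card S) / real n * of_bool (u \<in> T) + real (card S) / real n * (real (card T) / real n))"
    by (intro sum.cong) (auto simp: centred_indicator_def algebra_simps)
  also have "\<dots> = real (card (S \<inter> T)) - real (card T) / real n * real (card S)
        - real (card S) / real n * real (card T) + real n * (real (card S) / real n * (real (card T) / real n))"
    unfolding sum.distrib sum_subtractf sum_distrib_left[symmetric] sum_of_bool_mem[OF assms(1)]
      sum_of_bool_mem[OF assms(2)] sum_of_bool_mem[OF Int_subset] by simp
  finally show ?thesis using assms(3) by simp
qed

section \<open>Pseudoinverse and biharmonic index of the double star\<close>

text \<open>Rooting the double star at \<open>0\<close>, edge \<open>j\<close> joins \<open>Suc j\<close> to its parent, and \<open>ds_subtree a b j\<close>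
  is the component of \<open>Suc j\<close> once this edge is removed.\<close>

definition ds_parent :: "nat \<Rightarrow> nat \<Rightarrow> nat" where
  "ds_parent a j = (if j \<le> a then 0 else 1)"

definition ds_subtree :: "nat \<Rightarrow> nat \<Rightarrow> nat \<Rightarrow> nat set" where
  "ds_subtree a b j = (if j = 0 then insert 1 {a + 2..<a + b + 2} else {Suc j})"

lemma ds_subtree_subset: "j < a + b + 1 \<Longrightarrow> ds_subtree a b j \<subseteq> {..<a + b + 2}"
  by (auto simp: ds_subtree_def)

lemma card_ds_subtree: "card (ds_subtree a b j) = (if j = 0 then b + 1 else 1)"
  by (simp add: ds_subtree_def)

lemma pverts_double_star: "pverts (double_star a b) = {0..<a + b + 2}"
  by (simp add: double_star_def)

lemma parcs_double_star:
  "parcs (double_star a b) = (\<lambda>j. (Suc j, ds_parent a j)) ` {..<a + b + 1} \<union>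
    (\<lambda>j. (ds_parent a j, Suc j)) ` {..<a + b + 1}"
proof -
  have "(\<lambda>j. (ds_parent a j, Suc j)) ` {..<a + b + 1} = double_star_edges a b"
  proof -
    have "{..<a + b + 1} = {0} \<union> {1..<a + 1} \<union> {a + 1..<a + b + 1}" by auto
    moreover have "(\<lambda>j. (ds_parent a j, Suc j)) ` {1..<a + 1} = Pair 0 ` Suc ` {1..<a + 1}"
      unfolding image_image by (intro image_cong) (auto simp: ds_parent_def)
    moreover have "(\<lambda>j. (ds_parent a j, Suc j)) ` {a + 1..<a + b + 1} = Pair 1 ` Suc ` {a + 1..<a + b + 1}"
      unfolding image_image by (intro image_cong) (auto simp: ds_parent_def)
    ultimately show ?thesis
      by (simp add: image_Un double_star_edges_def ds_parent_def numeral_2_eq_2)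
  qed
  moreover from this[symmetric]
  have "(\<lambda>j. (Suc j, ds_parent a j)) ` {..<a + b + 1} = (double_star_edges a b)\<inverse>"
    by (auto simp: image_iff)
  ultimately show ?thesis by (auto simp: double_star_def)
qed

lemma moore_penrose_double_star:
  fixes a b :: nat
  defines "H \<equiv> mat (a + b + 2) (a + b + 1)
    (\<lambda>(u, j). centred_indicator (a + b + 2) (ds_subtree a b j) u)"
  shows "moore_penrose (laplacian_mat (double_star a b)) = H * transpose_mat H"
proof -
  define n m where "n = a + b + 2" and "m = a + b + 1"
  have nm: "n = Suc m" by (simp add: n_def m_def)
  define h where "h u j = centred_indicator n (ds_subtree a b j) u" for u j
  define B :: "real mat" where
    "B = mat n m (\<lambda>(u, j). of_bool (u = Suc j) - of_bool (u = ds_parent a j))"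
  have B: "B \<in> carrier_mat n m" and H: "H \<in> carrier_mat n m"
    by (auto simp: B_def H_def n_def m_def)
  have H_index: "H $$ (u, j) = h u j" if "u < n" "j < m" for u j
    using that by (simp add: H_def h_def n_def m_def)
  have L: "laplacian_mat (double_star a b) = B * transpose_mat B"
    unfolding B_def nm
    by (rule laplacian_mat_eq_incidence)
      (auto simp: pverts_double_star parcs_double_star m_def ds_parent_def)
  have inv: "transpose_mat B * H = 1\<^sub>m m"
  proof (rule eq_matI)
    fix j k assume "j < dim_row (1\<^sub>m m :: real mat)" "k < dim_col (1\<^sub>m m :: real mat)"
    then have jk: "j < m" "k < m" by auto
    have less: "Suc j < n" "ds_parent a j < n"
      using jk by (auto simp: nm ds_parent_def)
    have "(transpose_mat B * H) $$ (j, k) =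
        (\<Sum>u<n. (of_bool (u = Suc j) - of_bool (u = ds_parent a j)) * h u k)"
      using jk B H by (simp add: scalar_prod_def atLeast0LessThan H_index) (simp add: B_def)
    also have "\<dots> = (\<Sum>u<n. if u = Suc j then h u k else 0) -
        (\<Sum>u<n. if u = ds_parent a j then h u k else 0)"
      unfolding sum_subtractf[symmetric] by (intro sum.cong) auto
    also have "\<dots> = h (Suc j) k - h (ds_parent a j) k"
      using less by simp
    \<comment> \<open>The centring constants cancel. Removing edge \<open>k\<close> separates the
      ends of edge \<open>j\<close> only if \<open>j = k\<close>, with \<open>Suc j\<close> on the
      subtree side.\<close>
    also have "\<dots> = of_bool (j = k)"
      using jk by (auto simp: h_def centred_indicator_def ds_subtree_def ds_parent_def m_def)
    finally show "(transpose_mat B * H) $$ (j, k) = 1\<^sub>m m $$ (j, k)"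
      using jk by simp
  qed (use B H in auto)
  have BH: "(B * transpose_mat H) $$ (u, v) = of_bool (u = v) - 1 / n" if uv: "u < n" "v < n" for u v
  proof -
    have "(B * transpose_mat H) $$ (u, v) =
        (\<Sum>j<m. (of_bool (u = Suc j) - of_bool (u = ds_parent a j)) * h v j)"
      using uv B H by (simp add: scalar_prod_def atLeast0LessThan H_index) (simp add: B_def)
    \<comment> \<open>The central edge, the pendant edges at 0 and the pendant edges at 1.\<close>
    also have "{..<m} = {0} \<union> {1..a} \<union> {a + 1..a + b}"
      by (auto simp: m_def)
    also have "(\<Sum>j\<in>{0} \<union> {1..a} \<union> {a + 1..a + b}. (of_bool (u = Suc j) - of_bool (u = ds_parent a j)) * h v j) =
        (of_bool (u = 1) - of_bool (u = 0)) * h v 0 +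
        (\<Sum>j\<in>{1..a}. (of_bool (u = Suc j) - of_bool (u = 0)) * h v j) +
        (\<Sum>j\<in>{a + 1..a + b}. (of_bool (u = Suc j) - of_bool (u = 1)) * h v j)"
      by (subst sum.union_disjoint; (subst sum.union_disjoint)?) (auto simp: ds_parent_def)
    also have "(\<Sum>j\<in>{1..a}. (of_bool (u = Suc j) - of_bool (u = 0)) * h v j) =
        (\<Sum>j\<in>{1..a}. of_bool (u = Suc j) * h v j) - of_bool (u = 0) * (\<Sum>j\<in>{1..a}. h v j)"
      by (simp add: left_diff_distrib sum_subtractf sum_distrib_left)
    also have "(\<Sum>j\<in>{a + 1..a + b}. (of_bool (u = Suc j) - of_bool (u = 1)) * h v j) =
        (\<Sum>j\<in>{a + 1..a + b}. of_bool (u = Suc j) * h v j) - of_bool (u = 1) * (\<Sum>j\<in>{a + 1..a + b}. h v j)"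
      by (simp add: left_diff_distrib sum_subtractf sum_distrib_left)
    also have "(\<Sum>j\<in>{1..a}. of_bool (u = Suc j) * h v j) = of_bool (u \<in> {2..a + 1}) * h v (u - 1)"
    proof -
      \<comment> \<open>A nonzero vertex \<open>u\<close> is the child end of edge
        \<open>u - 1\<close> alone, so at most one term survives.\<close>
      have "(\<Sum>j\<in>{1..a}. of_bool (u = Suc j) * h v j) = (\<Sum>j\<in>{1..a}. if u - 1 = j then of_bool (u \<noteq> 0) * h v j else 0)"
        by (intro sum.cong) auto
      then show ?thesis by (auto simp: of_bool_def)
    qed
    also have "(\<Sum>j\<in>{a + 1..a + b}. of_bool (u = Suc j) * h v j) =
        of_bool (u \<in> {a + 2..a + b + 1}) * h v (u - 1)"
    proof -
      have "(\<Sum>j\<in>{a + 1..a + b}. of_bool (u = Suc j) * h v j) =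
          (\<Sum>j\<in>{a + 1..a + b}. if u - 1 = j then of_bool (u \<noteq> 0) * h v j else 0)"
        by (intro sum.cong) auto
      then show ?thesis by (auto simp: of_bool_def)
    qed
    also have "(\<Sum>j\<in>{1..a}. h v j) = of_bool (v \<in> {2..a + 1}) - a / n"
    proof -
      have "(\<Sum>j\<in>{1..a}. h v j) = (\<Sum>j\<in>{1..a}. (if v - 1 = j then of_bool (v \<noteq> 0) else 0) - 1 / n)"
        by (intro sum.cong) (auto simp: h_def centred_indicator_def ds_subtree_def)
      then show ?thesis by (auto simp: sum_subtractf)
    qed
    also have "(\<Sum>j\<in>{a + 1..a + b}. h v j) = of_bool (v \<in> {a + 2..a + b + 1}) - b / n"
    proof -
      have "(\<Sum>j\<in>{a + 1..a + b}. h v j) =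
          (\<Sum>j\<in>{a + 1..a + b}. (if v - 1 = j then of_bool (v \<noteq> 0) else 0) - 1 / n)"
        by (intro sum.cong) (auto simp: h_def centred_indicator_def ds_subtree_def)
      then show ?thesis by (auto simp: sum_subtractf)
    qed
    also have "(of_bool (u = 1) - of_bool (u = 0)) * h v 0 +
        (of_bool (u \<in> {2..a + 1}) * h v (u - 1) - of_bool (u = 0) * (of_bool (v \<in> {2..a + 1}) - a / n)) +
        (of_bool (u \<in> {a + 2..a + b + 1}) * h v (u - 1) - of_bool (u = 1) * (of_bool (v \<in> {a + 2..a + b + 1}) - b / n))
        = of_bool (u = v) - 1 / n"
    \<comment> \<open>Only the rows of the two centres collect several edges. At
      \<open>u = 0\<close> the constants are \<open>(b + 1) / n\<close> from the central edge and
      \<open>a / n\<close> from the leaves at 0; at \<open>u = 1\<close> they are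
      \<open>- (b + 1) / n\<close> and \<open>b / n\<close>.\<close>
    proof -
      consider "u = 0" | "u = 1" | "2 \<le> u" by linarith
      then show ?thesis
      proof cases
        case 1
        have "1 + real b + a + 1 = n" "real n > 0"
          by (simp_all add: n_def)
        then have "(1 + real b) / n + a / n = 1 - 1 / n"
          by (simp add: field_simps)
        then show ?thesis
          using 1 uv by (auto simp: h_def centred_indicator_def card_ds_subtree)
            (auto simp: ds_subtree_def n_def)
      next
        case 2
        have "(1 + real b) / n - b / n = 1 / n"
          by (simp add: add_divide_distrib)
        then show ?thesis
          using 2 uv by (auto simp: h_def centred_indicator_def card_ds_subtree)
            (auto simp: ds_subtree_def n_def)
      next
        case 3
        then show ?thesis
          using uv by (auto simp: h_def centred_indicator_def ds_subtree_def n_def)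
      qed
    qed
    finally show ?thesis .
  qed
  have "transpose_mat (B * transpose_mat H) = B * transpose_mat H"
    by (rule eq_matI) (use B H BH in auto)
  then show ?thesis
    unfolding L by (intro moore_penrose_eqI is_moore_penrose_mult_transpose[OF B H inv])
qed

text \<open>The Gram matrix has one entry for the central edge with itself, a row and a column
  pairing it with the pendant edges, and a block of pendant edges. The squares are summed over each
  piece.\<close>

lemma biharmonic_index_double_star:
  fixes a b :: nat
  defines "n \<equiv> real a + real b + 2"
  shows "biharmonic_index (double_star a b) =
    n\<^sup>2 - 2 * n + 4 * (real a * real b) + (real a * real b + 1)\<^sup>2 / n"
proof -
  define m where "m = a + b + 1"
  define g where "g j k = (\<Sum>u<a + b + 2. centred_indicator (a + b + 2) (ds_subtree a b j) u *
    centred_indicator (a + b + 2) (ds_subtree a b k) u)" for j k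
  have n: "n > 0" by (simp add: n_def)
  have g: "g j k = real (card (ds_subtree a b j \<inter> ds_subtree a b k)) -
      real (card (ds_subtree a b j)) * real (card (ds_subtree a b k)) / n"
    if "j < m" "k < m" for j k
    using that unfolding g_def n_def m_def
    by (subst sum_centred_indicator_mult[OF ds_subtree_subset ds_subtree_subset])
      (auto simp: algebra_simps)
  \<comment> \<open>\<open>(b + 1) - (b + 1)\<^sup>2 / n\<close>, where
    \<open>n - (b + 1) = a + 1\<close> is the size of the other component.\<close>
  have g00: "g 0 0 = (real a + 1) * (real b + 1) / n"
    using n by (subst g) (auto simp: m_def ds_subtree_def n_def field_simps)
  \<comment> \<open>The leaf \<open>Suc j\<close> lies below the central edge exactly when it is
    pendant at 1, that is, when \<open>a < j\<close>.\<close>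
  have g0: "g 0 j = of_bool (a < j) - (real b + 1) / n" "g j 0 = of_bool (a < j) - (real b + 1) / n"
    if "0 < j" "j < m" for j
    using that by (auto simp: g m_def card_ds_subtree) (auto simp: ds_subtree_def)
  have gg: "g j k = of_bool (j = k) - 1 / n" if "0 < j" "j < m" "0 < k" "k < m" for j k
    using that by (auto simp: g m_def card_ds_subtree) (auto simp: ds_subtree_def)
  have split: "{..<m} = insert 0 {1..a + b}" by (auto simp: m_def)
  have row: "(\<Sum>j\<in>{1..a + b}. (of_bool (a < j) - (real b + 1) / n)\<^sup>2) =
      a * ((real b + 1) / n)\<^sup>2 + b * ((real a + 1) / n)\<^sup>2"
  proof -
    have "{1..a + b} = {1..a} \<union> {a + 1..a + b}" by auto
    then have "(\<Sum>j\<in>{1..a + b}. (of_bool (a < j) - (real b + 1) / n)\<^sup>2) =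
        (\<Sum>j\<in>{1..a}. ((real b + 1) / n)\<^sup>2) + (\<Sum>j\<in>{a + 1..a + b}. (1 - (real b + 1) / n)\<^sup>2)"
      by (simp add: sum.union_disjoint)
    also have "1 - (real b + 1) / n = (real a + 1) / n"
      using n by (simp add: n_def field_simps)
    finally show ?thesis by simp
  qed
  \<comment> \<open>There are \<open>n - 2\<close> pendant edges, so each row has one diagonal entry
    and \<open>n - 3\<close> others.\<close>
  have block: "(\<Sum>j\<in>{1..a + b}. \<Sum>k\<in>{1..a + b}. (of_bool (j = k) - 1 / n)\<^sup>2) =
      (n - 2) * ((1 - 1 / n)\<^sup>2 + (n - 3) * (1 / n)\<^sup>2)"
  proof -
    have "(\<Sum>k\<in>{1..a + b}. (of_bool (j = k) - 1 / n)\<^sup>2) = (1 - 1 / n)\<^sup>2 + (n - 3) * (1 / n)\<^sup>2"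
      if "j \<in> {1..a + b}" for j
    proof -
      have "(\<Sum>k\<in>{1..a + b}. (of_bool (j = k) - 1 / n)\<^sup>2) =
          (\<Sum>k\<in>{1..a + b}. (if j = k then (1 - 1 / n)\<^sup>2 - (1 / n)\<^sup>2 else 0) + (1 / n)\<^sup>2)"
        by (intro sum.cong) auto
      also have "\<dots> = (1 - 1 / n)\<^sup>2 - (1 / n)\<^sup>2 + (n - 2) * (1 / n)\<^sup>2"
        using that by (simp add: sum.distrib n_def)
      finally show ?thesis by (simp add: algebra_simps)
    qed
    then show ?thesis by (simp add: n_def)
  qed
  have "biharmonic_index (double_star a b) = real (a + b + 2) * (\<Sum>j<m. \<Sum>k<m. (g j k)\<^sup>2)"
    unfolding g_def m_def
    by (rule biharmonic_index_gram[OF pverts_double_star moore_penrose_double_star])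
      (rule sum_centred_indicator[OF ds_subtree_subset], simp_all)
  also have "(\<Sum>j<m. \<Sum>k<m. (g j k)\<^sup>2) = (g 0 0)\<^sup>2 + (\<Sum>k\<in>{1..a + b}. (g 0 k)\<^sup>2) +
      (\<Sum>j\<in>{1..a + b}. (g j 0)\<^sup>2) + (\<Sum>j\<in>{1..a + b}. \<Sum>k\<in>{1..a + b}. (g j k)\<^sup>2)"
    unfolding split by (simp add: sum.distrib)
  also have "(\<Sum>k\<in>{1..a + b}. (g 0 k)\<^sup>2) = a * ((real b + 1) / n)\<^sup>2 + b * ((real a + 1) / n)\<^sup>2"
    unfolding row[symmetric] by (intro sum.cong) (auto simp: g0 m_def)
  also have "(\<Sum>j\<in>{1..a + b}. (g j 0)\<^sup>2) = a * ((real b + 1) / n)\<^sup>2 + b * ((real a + 1) / n)\<^sup>2"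
    unfolding row[symmetric] by (intro sum.cong) (auto simp: g0 m_def)
  also have "(\<Sum>j\<in>{1..a + b}. \<Sum>k\<in>{1..a + b}. (g j k)\<^sup>2) =
      (n - 2) * ((1 - 1 / n)\<^sup>2 + (n - 3) * (1 / n)\<^sup>2)"
    unfolding block[symmetric] by (intro sum.cong) (auto simp: gg m_def)
  also have "real (a + b + 2) = n" by (simp add: n_def)
  also have "n * ((g 0 0)\<^sup>2 + (a * ((real b + 1) / n)\<^sup>2 + b * ((real a + 1) / n)\<^sup>2) +
      (a * ((real b + 1) / n)\<^sup>2 + b * ((real a + 1) / n)\<^sup>2) +
      (n - 2) * ((1 - 1 / n)\<^sup>2 + (n - 3) * (1 / n)\<^sup>2)) =
      (((real a + 1) * (real b + 1))\<^sup>2 + 2 * real a * (real b + 1)\<^sup>2 + 2 * real b * (real a + 1)\<^sup>2 +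
       (n - 2) * ((n - 1)\<^sup>2 + (n - 3))) / n"
    unfolding g00 using n by (simp add: field_simps power2_eq_square)
  \<comment> \<open>A polynomial identity in \<open>a\<close> and \<open>b\<close> after
    substituting \<open>n = a + b + 2\<close>; it separates the multiple of \<open>n\<close> from
    the term left over the denominator.\<close>
  also have "((real a + 1) * (real b + 1))\<^sup>2 + 2 * real a * (real b + 1)\<^sup>2 + 2 * real b * (real a + 1)\<^sup>2 +
       (n - 2) * ((n - 1)\<^sup>2 + (n - 3)) =
      n * (n\<^sup>2 - 2 * n + 4 * (real a * real b)) + (real a * real b + 1)\<^sup>2"
    unfolding n_def by (simp add: power2_eq_square algebra_simps)
  also have "\<dots> / n = n\<^sup>2 - 2 * n + 4 * (real a * real b) + (real a * real b + 1)\<^sup>2 / n"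
    using n by (simp add: add_divide_distrib)
  finally show ?thesis .
qed

section \<open>Isomorphism classes of double stars\<close>

lemma out_degree_double_star:
  assumes "v < a + b + 2"
  shows "out_degree (with_proj (double_star a b)) v =
    (if v = 0 then a + 1 else if v = 1 then b + 1 else 1)"
proof -
  have "out_arcs (with_proj (double_star a b)) v =
      (if v = 0 then Pair 0 ` ({1} \<union> {2..<a + 2})
       else if v = 1 then Pair 1 ` ({0} \<union> {a + 2..<a + b + 2})
       else if v < a + 2 then {(v, 0)} else {(v, 1)})"
    using assms by (auto simp: out_arcs_def double_star_def double_star_edges_def)
  moreover have "card (Pair 0 ` ({1} \<union> {2..<a + 2}) :: (nat \<times> nat) set) = a + 1"
    by (subst card_image) (auto simp: inj_on_def)
  moreover have "card (Pair 1 ` ({0} \<union> {a + 2..<a + b + 2}) :: (nat \<times> nat) set) = b + 1"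
    by (subst card_image) (auto simp: inj_on_def)
  ultimately show ?thesis by (simp add: out_degree_def)
qed

lemma graph_isoI:
  assumes "pair_graph G" and inj: "inj_on \<phi> (pverts G)"
    and verts: "\<phi> ` pverts G = pverts H" and arcs: "map_prod \<phi> \<phi> ` parcs G = parcs H"
  shows "graph_iso G H"
proof -
  interpret pair_graph G by fact
  define hom where
    "hom = \<lparr>iso_verts = \<phi>, iso_arcs = map_prod \<phi> \<phi>, iso_head = snd, iso_tail = fst\<rparr>"
  have "inj_on (map_prod \<phi> \<phi>) (parcs G)"
  proof (rule inj_on_subset)
    show "inj_on (map_prod \<phi> \<phi>) (pverts G \<times> pverts G)"
      using inj by (intro map_prod_inj_on)
    show "parcs G \<subseteq> pverts G \<times> pverts G"
      using in_arcsD1 in_arcsD2 by fastforce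
  qed
  then have "digraph_isomorphism hom"
    using inj wf_digraph_axioms by (auto simp: digraph_isomorphism_def hom_def)
  moreover have "with_proj H = app_iso hom (with_proj G)"
    using verts arcs by (simp add: app_iso_def hom_def with_proj_def)
  ultimately show ?thesis by (auto simp: digraph_iso_def)
qed

text \<open>The map \<open>\<phi>\<close> exchanges the two centres and slides the two blocks of
  leaves past each other.\<close>

lemma graph_iso_double_star_commute: "graph_iso (double_star a b) (double_star b a)"
proof -
  define \<phi> where "\<phi> v = (if v = 0 then 1 else if v = 1 then 0 else if v < a + 2 then v + b else v - a)"
    for v :: nat
  have shift_a: "\<phi> ` {2..<a + 2} = {b + 2..<b + a + 2}"
  proof -
    have "\<phi> ` {2..<a + 2} = (\<lambda>v. v + b) ` {2..<a + 2}"
      by (intro image_cong) (auto simp: \<phi>_def)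
    then show ?thesis by (simp add: ac_simps)
  qed
  have shift_b: "\<phi> ` {a + 2..<a + b + 2} = {2..<b + 2}"
  proof -
    have "\<phi> ` {a + 2..<a + b + 2} = (\<lambda>v. v - a) ` {a + 2..<a + b + 2}"
      by (intro image_cong) (auto simp: \<phi>_def)
    also have "\<dots> = {2..<b + 2}"
    proof -
      have "x \<in> (\<lambda>v. v - a) ` {a + 2..<a + b + 2}" if "x \<in> {2..<b + 2}" for x
        using that by (intro image_eqI[of _ _ "x + a"]) auto
      then show ?thesis by auto
    qed
    finally show ?thesis .
  qed
  have \<phi>01: "\<phi> 0 = 1" "\<phi> 1 = 0" by (simp_all add: \<phi>_def)
  have verts: "\<phi> ` {0..<a + b + 2} = {0..<b + a + 2}"
  proof -
    have "{0..<a + b + 2} = {0, 1} \<union> {2..<a + 2} \<union> {a + 2..<a + b + 2}" by auto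
    then have "\<phi> ` {0..<a + b + 2} = {1, 0} \<union> {b + 2..<b + a + 2} \<union> {2..<b + 2}"
      by (simp only: image_Un image_insert image_empty shift_a shift_b \<phi>01)
    then show ?thesis by auto
  qed
  \<comment> \<open>A map of a finite set onto one of the same size is injective.\<close>
  have inj: "inj_on \<phi> {0..<a + b + 2}"
    by (rule eq_card_imp_inj_on) (simp_all only: verts card_atLeastLessThan finite_atLeastLessThan add.commute)
  have edges: "map_prod \<phi> \<phi> ` double_star_edges a b =
      insert (1, 0) (Pair 0 ` {2..<b + 2} \<union> Pair 1 ` {b + 2..<b + a + 2})"
  proof -
    have image_Pair: "map_prod \<phi> \<phi> ` Pair x ` S = Pair (\<phi> x) ` \<phi> ` S" for x S
      by (auto simp: image_image)
    have "map_prod \<phi> \<phi> ` {(0, 1)} = {(1, 0)}"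
      by (simp add: \<phi>_def)
    then show ?thesis
      unfolding double_star_edges_def image_Un image_Pair \<phi>01 shift_a shift_b by auto
  qed
  have arcs: "map_prod \<phi> \<phi> ` parcs (double_star a b) = parcs (double_star b a)"
  proof -
    have "map_prod \<phi> \<phi> ` (R\<inverse>) = (map_prod \<phi> \<phi> ` R)\<inverse>" for R by force
    then have "map_prod \<phi> \<phi> ` parcs (double_star a b) =
        map_prod \<phi> \<phi> ` double_star_edges a b \<union> (map_prod \<phi> \<phi> ` double_star_edges a b)\<inverse>"
      by (simp add: double_star_def image_Un)
    then show ?thesis
      unfolding edges by (auto simp: double_star_def double_star_edges_def)
  qed
  show ?thesis
    by (rule graph_isoI[OF pair_graph_double_star, of \<phi>])
      (simp_all only: pverts_double_star inj verts arcs)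
qed

text \<open>An isomorphism sends vertex 0, of degree \<open>a + 1 \<ge> 2\<close>, to a vertex that
  is no leaf, hence to a centre of degree \<open>c + 1\<close> or \<open>d + 1\<close>. Conversely,
  sum and product determine the unordered pair.\<close>

lemma graph_iso_double_star_iff:
  assumes "a \<ge> 1" "b \<ge> 1" "a + b = c + d"
  shows "graph_iso (double_star a b) (double_star c d) \<longleftrightarrow> a * b = c * d"
proof
  interpret pair_graph "double_star a b" by (rule pair_graph_double_star)
  assume "graph_iso (double_star a b) (double_star c d)"
  then obtain hom where hom: "digraph_isomorphism hom"
    and eq: "with_proj (double_star c d) = app_iso hom (with_proj (double_star a b))"
    by (auto simp: digraph_iso_def)
  have "iso_verts hom 0 \<in> verts (app_iso hom (with_proj (double_star a b)))"
    by (auto simp: double_star_def)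
  then have v: "iso_verts hom 0 < c + d + 2"
    unfolding eq[symmetric] by (simp add: double_star_def)
  have "out_degree (with_proj (double_star c d)) (iso_verts hom 0) = a + 1"
    using out_degree_app_iso_eq[OF hom, of 0] out_degree_double_star[of 0 a b]
    unfolding eq by (simp add: double_star_def)
  then have "a = c \<or> a = d"
    unfolding out_degree_double_star[OF v] using assms by (auto split: if_splits)
  then show "a * b = c * d" using assms by auto
next
  assume "a * b = c * d"
  \<comment> \<open>\<open>a\<close> is a root of \<open>(x - c) (x - d)\<close>; integers avoid
    truncated subtraction.\<close>
  have "(int a - int c) * (int a - int d) = int a * (int a + int b - int c - int d) - (int a * int b - int c * int d)"
    by (simp add: algebra_simps)
  also have "\<dots> = 0"
    using \<open>a * b = c * d\<close> \<open>a + b = c + d\<close> by (simp flip: of_nat_mult of_nat_add)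
  finally have "a = c \<and> b = d \<or> a = d \<and> b = c"
    using assms by auto
  moreover have "graph_iso (double_star a b) (double_star a b)"
    by (rule graph_isoI[OF pair_graph_double_star, of id]) (simp_all add: prod.map_id0)
  ultimately show "graph_iso (double_star a b) (double_star c d)"
    using graph_iso_double_star_commute by auto
qed

section \<open>Extremal products and the bounds\<close>

text \<open>The two halves \<open>f \<le> c\<close> differ by at most 1, so no integer lies strictly
  between them and \<open>(a - f) (a - c) \<ge> 0\<close>. As \<open>b = c + f - a\<close>, this
  product is the difference of the two sides.\<close>

lemma mult_le_ceil_half_mult_floor_half:
  fixes a b :: nat
  shows "a * b \<le> ((a + b + 1) div 2) * ((a + b) div 2)"
proof -
  define c f where "c = (a + b + 1) div 2" and "f = (a + b) div 2"
  have cf: "c + f = a + b" "f \<le> c" "c \<le> f + 1" by (auto simp: c_def f_def)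
  have "0 \<le> (int a - int f) * (int a - int c)"
  proof (cases "a \<le> f")
    case True
    then show ?thesis using cf by (intro mult_nonpos_nonpos) auto
  next
    case False
    then show ?thesis using cf by (intro mult_nonneg_nonneg) auto
  qed
  also have "\<dots> = int c * int f - int a * (int c + int f - int a)" by (simp add: algebra_simps)
  also have "int c + int f - int a = int b" using cf by linarith
  finally show ?thesis unfolding c_def[symmetric] f_def[symmetric]
    by (simp flip: of_nat_mult)
qed

theorem theorem5p1:
  fixes n a b :: nat
  assumes "n \<ge> 4" and "a \<ge> 1" and "b \<ge> 1" and "a + b = n - 2"
  defines "c \<equiv> \<lceil>(real n - 2) / 2\<rceil>" and "f \<equiv> \<lfloor>(real n - 2) / 2\<rfloor>"
  defines "lower \<equiv> real n ^ 2 + 3 * real n + 4 / real n - 16"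
    and "upper \<equiv> real n ^ 2 - 2 * real n + 4 * real_of_int c * real_of_int f
                 + (real_of_int c * real_of_int f + 1) ^ 2 / real n"
  shows "lower \<le> biharmonic_index (double_star a b)
       \<and> biharmonic_index (double_star a b) \<le> upper
       \<and> (lower = biharmonic_index (double_star a b)
            \<longleftrightarrow> graph_iso (double_star a b) (double_star 1 (n - 3)))
       \<and> (biharmonic_index (double_star a b) = upper
            \<longleftrightarrow> graph_iso (double_star a b) (double_star (nat c) (nat f)))"
proof -
  \<comment> \<open>The index as a function of \<open>q = a b\<close> for fixed \<open>n\<close>;
    both bounds are values of \<open>F\<close>.\<close>
  define F where "F q = real n ^ 2 - 2 * real n + 4 * q + (q + 1)\<^sup>2 / real n" for q
  \<comment> \<open>The linear term \<open>4 q\<close> supplies the strictness, which settles the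
    equality cases.\<close>
  have mono: "F x < F y" if "0 \<le> x" "x < y" for x y
  proof -
    have "(x + 1)\<^sup>2 / real n \<le> (y + 1)\<^sup>2 / real n"
      using that by (intro divide_right_mono power_mono) auto
    then show ?thesis using that by (simp add: F_def)
  qed
  have F_le: "F (real x) \<le> F (real y) \<longleftrightarrow> x \<le> y" and F_eq: "F (real x) = F (real y) \<longleftrightarrow> x = y" for x y
    using mono[of "real x" "real y"] mono[of "real y" "real x"]
    by (cases x y rule: linorder_cases; force)+
  define c' f' where "c' = (a + b + 1) div 2" and "f' = (a + b) div 2"
  have "a + b \<le> 2 * c'" "2 * c' \<le> a + b + 1" "2 * f' \<le> a + b" "a + b \<le> 2 * f' + 1"
    by (auto simp: c'_def f'_def)
  then have half: "real (a + b) \<le> 2 * real c'" "2 * real c' \<le> real (a + b) + 1"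
    "2 * real f' \<le> real (a + b)" "real (a + b) \<le> 2 * real f' + 1"
    by linarith+
  have n: "real n - 2 = real (a + b)" using assms by linarith
  have c: "c = int c'"
    unfolding c_def n by (rule ceiling_unique) (use half in simp_all)
  have f: "f = int f'"
    unfolding f_def n by (rule floor_unique) (use half in simp_all)
  have BH: "biharmonic_index (double_star a b) = F (real (a * b))"
    unfolding biharmonic_index_double_star F_def using n by (simp add: algebra_simps)
  have upper: "upper = F (real (c' * f'))"
    by (simp add: upper_def F_def c f)
  \<comment> \<open>At \<open>q = n - 3\<close> the last term of \<open>F\<close> is
    \<open>(n - 2)\<^sup>2 / n = n - 4 + 4 / n\<close>.\<close>
  have lower: "lower = F (real (1 * (n - 3)))"
  proof -
    have "real (n - 3) = real n - 3" using assms by linarith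
    then show ?thesis
      using assms(1) by (simp add: lower_def F_def power2_eq_square field_simps)
  qed
  \<comment> \<open>This is \<open>(a - 1) (b - 1) \<ge> 0\<close> with
    \<open>a + b = n - 2\<close>.\<close>
  have "1 * (n - 3) \<le> a * b"
  proof -
    obtain a' b' where "a = Suc a'" "b = Suc b'"
      using assms by (metis Suc_le_D One_nat_def)
    then show ?thesis using assms by simp
  qed
  moreover have "a * b \<le> c' * f'"
    unfolding c'_def f'_def by (rule mult_le_ceil_half_mult_floor_half)
  moreover have "graph_iso (double_star a b) (double_star 1 (n - 3)) \<longleftrightarrow> a * b = 1 * (n - 3)"
    using assms by (intro graph_iso_double_star_iff) auto
  moreover have "graph_iso (double_star a b) (double_star c' f') \<longleftrightarrow> a * b = c' * f'"
    using assms by (intro graph_iso_double_star_iff) (auto simp: c'_def f'_def)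
  ultimately show ?thesis
    unfolding BH upper lower c f nat_int F_le F_eq by metis
qed

end
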